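(* Consider the problem $\min_{x\in\mathbb{R}^n}\{f(x)+g(x):h(x)=0\}$ under the assumptions stated in the context (including the descent solution oracle), and let $\{(x^k,\mu^k)\}_{k\in\mathbb{N}}$ be generated by UDD-ALM with nonlinear constraints. Let $x^*\in X$ be a limit point of $\{x^k\}_{k\in\mathbb{N}}$ that satisfies the LICQ condition, i.e., with $I(x^* )=\{l\in\{1,\dots,L\}:q_l(x^* )=0\}$, the matrix $$H^*:=[\nabla h_1(x^* ),\dots,\nabla h_m(x^* ),\{\nabla q_l(x^* )\}_{l\in I(x^* )}]\in\mathbb{R}^{n\times(m+|I(x^* )|)}$$ has full column rank. Then: 1. (Asymptotic convergence) $x^*$ is a KKT point of the problem. 2. (Iteration complexity) Let $\epsilon>0$ and define $\sigma_1:=\min\{\nu,\varrho\}$ and $\sigma_2:=c+(\rho+\varrho)\max_{x\in X}\|\nabla h(x)\|$. UDD-ALM finds an $\epsilon$-KKT point in at most $K$ iterations (that is, at least one of $x^0,\dots,x^K$ is an $\epsilon$-KKT point), where $$K\le\left\lceil\frac{\max\{1,\sigma_2\}^2\left(L_\rho(x^0,\mu^0)-f(x^* )-\tilde g(x^* )\right)}{\sigma_1\epsilon^2}\right\rceil=\mathcal{O}(\epsilon^{-2}).$$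
   Context: **Assumptions on the data.** (1) $g=\tilde g+\delta_X$, where $\delta_X$ is the $0/\infty$ indicator of a compact set $X=\{x\in\mathbb{R}^n:q_l(x)\le0,\ l=1,\dots,L\}$ with each $q_l:\mathbb{R}^n\to\mathbb{R}$ continuously differentiable, and $\tilde g:\mathbb{R}^n\to\mathbb{R}$ is continuous and convex over $X$. (2) $f:\mathbb{R}^n\to\mathbb{R}$ is continuously differentiable over $X$. (3) $h=[h_1,\dots,h_m]^\top:\mathbb{R}^n\to\mathbb{R}^m$ with each $h_j$ continuously differentiable over $X$; $\nabla h(x)=[\nabla h_1(x),\dots,\nabla h_m(x)]\in\mathbb{R}^{n\times m}$. **$\epsilon$-KKT point.** $x$ is an $\epsilon$-KKT point if there are $\mu\in\mathbb{R}^m$ and $y\in\mathbb{R}^L_+$ with $\mathrm{dist}\left(-\nabla f(x)-\nabla h(x)\mu-\sum_{l=1}^L\nabla q_l(x)y_l,\ \partial\tilde g(x)\right)\le\epsilon$, $\|h(x)\|\le\epsilon$, and $q_l(x)\le0$, $y_lq_l(x)=0$ for all $l$. A KKT point is the case $\epsilon=0$. Here $\mathrm{dist}(z,S)=\inf_{y\in S}\|y-z\|$. **Augmented Lagrangian.** $L_\rho(x,\mu)=f(x)+\tilde g(x)+\langle\mu,h(x)\rangle+\frac{\rho}{2}\|h(x)\|^2$, and $\partial_xL_\rho(x,\mu)=\nabla f(x)+\partial\tilde g(x)+\nabla h(x)(\mu+\rho h(x))$. **UDD-ALM with nonlinear constraints.** Initialize $x^0\in X$, $\mu^0\in\mathbb{R}^m$,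 $\rho\ge0$, $\varrho>0$, $c>0$. For $k=0,1,2,\dots$: obtain $x^{k+1}$ from the descent solution oracle below, applied to the subproblem $\min_{x\in X}L_\rho(x,\mu^k)+\frac{c}{2}\|x-x^k\|^2$; then set $\mu^{k+1}=\mu^k-\varrho h(x^{k+1})$. **Descent solution oracle (assumption).** There is $\nu>0$ (independent of $k$) such that, given $x^k\in X$ and $\mu^k\in\mathbb{R}^m$, one can find $x^{k+1}$ with $L_\rho(x^{k+1},\mu^k)\le L_\rho(x^k,\mu^k)-\nu\|x^{k+1}-x^k\|^2$ and for which there exists $y^{k+1}\in\mathbb{R}^L_+$ satisfying $0\in\partial_xL_\rho(x^{k+1},\mu^k)+c(x^{k+1}-x^k)+\sum_{l=1}^L\nabla q_l(x^{k+1})y_l^{k+1}$ and $q_l(x^{k+1})\le0$, $y_l^{k+1}q_l(x^{k+1})=0$ for all $l$. *)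

theory Defs
  imports "HOL-Analysis.Analysis" "HOL-Library.Landau_Symbols"
begin

definition gradient :: "('a::euclidean_space \<Rightarrow> real) \<Rightarrow> 'a \<Rightarrow> 'a"
  where "gradient f x = (THE D. GDERIV f x :> D)"

lemma GDERIV_gradient:
  fixes f :: "'a::euclidean_space \<Rightarrow> real"
  assumes "f differentiable (at x)"
  shows "GDERIV f x :> gradient f x"
proof -
  obtain f' where f': "(f has_derivative f') (at x)"
    using assms by (auto simp: differentiable_def)
  then interpret linear f' by (rule has_derivative_linear)
  define D where "D = (\<Sum>b\<in>Basis. f' b *\<^sub>R b)"
  have "f' v = v \<bullet> D" for v
  proof -
    have "f' v = f' (\<Sum>b\<in>Basis. (v \<bullet> b) *\<^sub>R b)"
      by (simp add: euclidean_representation)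
    also have "\<dots> = v \<bullet> D"
      by (simp add: sum scale D_def inner_sum_right mult.commute)
    finally show ?thesis .
  qed
  then have "f' = (\<lambda>v. v \<bullet> D)" by blast
  with f' have D: "GDERIV f x :> D" by (simp add: gderiv_def)
  have "E = D" if "GDERIV f x :> E" for E
  proof -
    have "(\<lambda>v. v \<bullet> E) = (\<lambda>v. v \<bullet> D)"
      using that D unfolding gderiv_def by (rule has_derivative_unique)
    then show ?thesis by (metis inner_commute vector_eq_ldot)
  qed
  with D show ?thesis unfolding gradient_def by (rule theI)
qed

text \<open>The derivative at a point of \<open>S\<close> is the full derivative in the ambient space, so
  that the gradient is well defined also where \<open>S\<close> has empty interior.\<close>

definition C1_over :: "'a::euclidean_space set \<Rightarrow> ('a \<Rightarrow> real) \<Rightarrow> bool"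
  where "C1_over S f \<longleftrightarrow> (\<forall>x\<in>S. f differentiable (at x)) \<and> continuous_on S (gradient f)"

text \<open>The library's \<^const>\<open>convex_on\<close> includes convexity of the set. Here the set
  may be nonconvex, and the inequality is required only for convex combinations inside it.\<close>

definition convex_over :: "'a::real_vector set \<Rightarrow> ('a \<Rightarrow> real) \<Rightarrow> bool"
  where "convex_over S g \<longleftrightarrow>
    (\<forall>x\<in>S. \<forall>y\<in>S. \<forall>t\<in>{0..1}. (1 - t) *\<^sub>R x + t *\<^sub>R y \<in> S \<longrightarrow>
       g ((1 - t) *\<^sub>R x + t *\<^sub>R y) \<le> (1 - t) * g x + t * g y)"

lemma convex_over_iff_convex_on:
  assumes "convex S"
  shows "convex_over S g \<longleftrightarrow> convex_on S g"
proof
  assume g: "convex_over S g"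
  show "convex_on S g"
  proof (rule convex_onI)
    fix t :: real and x y
    assume "0 < t" "t < 1" "x \<in> S" "y \<in> S"
    then show "g ((1 - t) *\<^sub>R x + t *\<^sub>R y) \<le> (1 - t) * g x + t * g y"
      using g convexD_alt[OF assms, of x y t] by (simp add: convex_over_def)
  qed (fact assms)
next
  assume "convex_on S g"
  then show "convex_over S g"
    unfolding convex_over_def by (auto intro: convex_onD)
qed

definition subdifferential :: "('a::real_inner \<Rightarrow> real) \<Rightarrow> 'a \<Rightarrow> 'a set"
  where "subdifferential g x = {v. \<forall>y. g y \<ge> g x + v \<bullet> (y - x)}"

text \<open>Extended-real valued, so that the distance to the empty set is \<open>\<infinity>\<close>
  (\<^const>\<open>infdist\<close> would give \<open>0\<close>).\<close>

definition dist_set :: "'a::real_normed_vector \<Rightarrow> 'a set \<Rightarrow> ereal"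
  where "dist_set z S = (INF y\<in>S. ereal (norm (y - z)))"

definition grad_mat :: "(real^'n \<Rightarrow> real^'m) \<Rightarrow> real^'n \<Rightarrow> real^'m^'n"
  where "grad_mat h x = (\<chi> i j. gradient (\<lambda>z. h z $ j) x $ i)"

definition eps_KKT ::
  "(real^'n \<Rightarrow> real) \<Rightarrow> (real^'n \<Rightarrow> real) \<Rightarrow> (real^'n \<Rightarrow> real^'m) \<Rightarrow>
   ('l::finite \<Rightarrow> real^'n \<Rightarrow> real) \<Rightarrow> real \<Rightarrow> real^'n \<Rightarrow> bool"
  where "eps_KKT f gt h q \<epsilon> x \<longleftrightarrow>
    (\<exists>(\<mu>::real^'m) (y::real^'l).
       (\<forall>l. y $ l \<ge> 0) \<and>
       dist_set (- gradient f x - grad_mat h x *v \<mu> - (\<Sum>l\<in>UNIV. y $ l *\<^sub>R gradient (q l) x))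
         (subdifferential gt x) \<le> ereal \<epsilon> \<and>
       norm (h x) \<le> \<epsilon> \<and>
       (\<forall>l. q l x \<le> 0 \<and> y $ l * q l x = 0))"

definition KKT ::
  "(real^'n \<Rightarrow> real) \<Rightarrow> (real^'n \<Rightarrow> real) \<Rightarrow> (real^'n \<Rightarrow> real^'m) \<Rightarrow>
   ('l::finite \<Rightarrow> real^'n \<Rightarrow> real) \<Rightarrow> real^'n \<Rightarrow> bool"
  where "KKT f gt h q x \<longleftrightarrow> eps_KKT f gt h q 0 x"

definition aug_lagrangian ::
  "(real^'n \<Rightarrow> real) \<Rightarrow> (real^'n \<Rightarrow> real) \<Rightarrow> (real^'n \<Rightarrow> real^'m) \<Rightarrow>
   real \<Rightarrow> real^'n \<Rightarrow> real^'m \<Rightarrow> real"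
  where "aug_lagrangian f gt h \<rho> x \<mu> = f x + gt x + \<mu> \<bullet> h x + \<rho> / 2 * (norm (h x))\<^sup>2"

definition subdiff_aug_lagrangian ::
  "(real^'n \<Rightarrow> real) \<Rightarrow> (real^'n \<Rightarrow> real) \<Rightarrow> (real^'n \<Rightarrow> real^'m) \<Rightarrow>
   real \<Rightarrow> real^'n \<Rightarrow> real^'m \<Rightarrow> (real^'n) set"
  where "subdiff_aug_lagrangian f gt h \<rho> x \<mu> =
    {gradient f x + \<xi> + grad_mat h x *v (\<mu> + \<rho> *\<^sub>R h x) | \<xi>. \<xi> \<in> subdifferential gt x}"

text \<open>\<open>x'\<close> is an admissible answer of the descent oracle (with constant \<open>\<nu>\<close>) to
  the query \<open>(x, \<mu>)\<close>.\<close>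

definition descent_oracle ::
  "(real^'n \<Rightarrow> real) \<Rightarrow> (real^'n \<Rightarrow> real) \<Rightarrow> (real^'n \<Rightarrow> real^'m) \<Rightarrow>
   ('l::finite \<Rightarrow> real^'n \<Rightarrow> real) \<Rightarrow> real \<Rightarrow> real \<Rightarrow> real \<Rightarrow>
   real^'n \<Rightarrow> real^'m \<Rightarrow> real^'n \<Rightarrow> bool"
  where "descent_oracle f gt h q \<rho> c \<nu> x \<mu> x' \<longleftrightarrow>
    aug_lagrangian f gt h \<rho> x' \<mu> \<le> aug_lagrangian f gt h \<rho> x \<mu> - \<nu> * (norm (x' - x))\<^sup>2 \<and>
    (\<exists>y::real^'l.
       (\<forall>l. y $ l \<ge> 0) \<and>
       0 \<in> {s + c *\<^sub>R (x' - x) + (\<Sum>l\<in>UNIV. y $ l *\<^sub>R gradient (q l) x') | s.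
              s \<in> subdiff_aug_lagrangian f gt h \<rho> x' \<mu>} \<and>
       (\<forall>l. q l x' \<le> 0 \<and> y $ l * q l x' = 0))"

definition UDD_ALM ::
  "(real^'n \<Rightarrow> real) \<Rightarrow> (real^'n \<Rightarrow> real) \<Rightarrow> (real^'n \<Rightarrow> real^'m) \<Rightarrow>
   ('l::finite \<Rightarrow> real^'n \<Rightarrow> real) \<Rightarrow> real \<Rightarrow> real \<Rightarrow> real \<Rightarrow> real \<Rightarrow>
   (nat \<Rightarrow> real^'n) \<Rightarrow> (nat \<Rightarrow> real^'m) \<Rightarrow> bool"
  where "UDD_ALM f gt h q \<rho> \<rho>d c \<nu> x \<mu> \<longleftrightarrow>
    (\<forall>l. q l (x 0) \<le> 0) \<and>
    (\<forall>k. descent_oracle f gt h q \<rho> c \<nu> (x k) (\<mu> k) (x (Suc k)) \<and>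
         \<mu> (Suc k) = \<mu> k - \<rho>d *\<^sub>R h (x (Suc k)))"

text \<open>The number of active indices depends on \<open>x\<close>, so the matrix of active gradients is
  given by its columns: full column rank means that the dimension of the column space equals
  the number of columns.\<close>

definition LICQ ::
  "(real^'n \<Rightarrow> real^'m) \<Rightarrow> ('l::finite \<Rightarrow> real^'n \<Rightarrow> real) \<Rightarrow> real^'n \<Rightarrow> bool"
  where "LICQ h q x \<longleftrightarrow>
    (let I = {l. q l x = 0} in
       dim (range (\<lambda>j. gradient (\<lambda>z. h z $ j) x) \<union> (\<lambda>l. gradient (q l) x) ` I)
         = CARD('m) + card I)"

end

theory Submission
  imports Defs
begin

text \<open>
  Since the dual step is a descent step, the value \<open>L\<^sub>\<rho>(x\<^sup>k, \<mu>\<^sup>k)\<close> decreases by at least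
  \<open>\<nu> \<parallel>x\<^sup>k\<^sup>+\<^sup>1 - x\<^sup>k\<parallel>\<^sup>2 + \<rho>d \<parallel>h(x\<^sup>k\<^sup>+\<^sup>1)\<parallel>\<^sup>2\<close> in each iteration. Along a subsequence converging to
  \<open>xstar\<close> the subgradients of \<open>gt\<close> are bounded, and LICQ then bounds the multipliers. So this
  monotone sequence has a convergent subsequence, hence converges; consequently \<open>x\<^sup>k\<^sup>+\<^sup>1 - x\<^sup>k\<close> and
  \<open>h(x\<^sup>k)\<close> vanish, the limit value is \<open>f xstar + gt xstar\<close>, and the oracle's stationarity
  condition passes to the limit. Telescoping the descent inequality gives the complexity bound,
  with \<open>\<mu>\<^sup>k + \<rho> h(x\<^sup>k\<^sup>+\<^sup>1)\<close> as multiplier at \<open>x\<^sup>k\<^sup>+\<^sup>1\<close>, for which the stationarity residual is just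
  \<open>c (x\<^sup>k\<^sup>+\<^sup>1 - x\<^sup>k)\<close>.
\<close>

section \<open>Subgradients: uniform bounds and closedness under limits\<close>

text \<open>A subgradient at a point of \<open>S\<close> is controlled by the values of \<open>g\<close> at the finitely
  many vertices of a box around \<open>S\<close>.\<close>

lemma bounded_subdifferentials:
  fixes g :: "'a::euclidean_space \<Rightarrow> real"
  assumes "bounded S" and "bdd_below (g ` S)"
  shows "bounded (\<Union>x\<in>S. subdifferential g x)"
proof -
  obtain R where R: "\<And>x. x \<in> S \<Longrightarrow> norm x \<le> R"
    using assms(1) by (auto simp: bounded_iff)
  obtain m where m: "\<And>x. x \<in> S \<Longrightarrow> m \<le> g x"
    using assms(2) by (auto simp: bdd_below_def)
  \<comment> \<open>The extra unit of radius leaves room for the point \<open>x + sgn v\<close>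
    below.\<close>
  have "bounded (cball (0::'a) (R + 1))" by simp
  then obtain a where a: "cball (0::'a) (R + 1) \<subseteq> cbox (-a) a"
    using bounded_subset_cbox_symmetric by metis
  obtain V where V: "finite V" "cbox (-a) a = convex hull V"
    using closed_interval_as_convex_hull by metis
  \<comment> \<open>\<open>C\<close> bounds \<open>g p - g x\<close> for all vertices
    \<open>p\<close> and all \<open>x\<close> in \<open>S\<close> at once: the sum dominates each
    \<open>g p\<close>, and \<open>m\<close> bounds \<open>g\<close> from below on
    \<open>S\<close>.\<close>
  define C where "C = (\<Sum>p\<in>V. \<bar>g p\<bar>) - m"
  have "norm v \<le> \<bar>C\<bar>" if x: "x \<in> S" and v: "v \<in> subdifferential g x" for x v
  proof (cases "v = 0")
    case False
    have "V \<subseteq> {p. v \<bullet> p \<le> v \<bullet> x + C}"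
    proof
      fix p assume p: "p \<in> V"
      have "g p \<ge> g x + v \<bullet> (p - x)" using v by (simp add: subdifferential_def)
      moreover have "g p \<le> (\<Sum>p\<in>V. \<bar>g p\<bar>)"
        using member_le_sum[OF p, of "\<lambda>p. \<bar>g p\<bar>"] V(1) by auto
      ultimately show "p \<in> {p. v \<bullet> p \<le> v \<bullet> x + C}"
        using m[OF x] by (simp add: C_def inner_diff_right)
    qed
    then have hull: "convex hull V \<subseteq> {p. v \<bullet> p \<le> v \<bullet> x + C}"
      by (simp add: subset_hull convex_halfspace_le)
    \<comment> \<open>Testing the half-space one unit away from \<open>x\<close> in direction
      \<open>v\<close> turns the inner product into \<open>norm v\<close>.\<close>
    have "norm (x + sgn v) \<le> R + 1"
      using norm_triangle_ineq[of x "sgn v"] R[OF x] False by (simp add: norm_sgn)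
    then have "x + sgn v \<in> convex hull V" using a V(2) by auto
    then have "v \<bullet> sgn v \<le> C" using hull by (auto simp: inner_add_right)
    moreover have "v \<bullet> sgn v = norm v"
      using False by (simp add: sgn_div_norm dot_square_norm power2_eq_square)
    ultimately show ?thesis by simp
  qed simp
  then show ?thesis by (auto simp: bounded_iff)
qed

text \<open>The subgradient inequality at each fixed \<open>y\<close> passes to the limit.
  Convergence of the values is a hypothesis because \<open>gt\<close> is assumed continuous only
  relative to \<open>X\<close>.\<close>

lemma subdifferential_limit:
  fixes g :: "'a::real_inner \<Rightarrow> real"
  assumes "\<And>j. v j \<in> subdifferential g (x j)"
    and "x \<longlonglongrightarrow> a" "v \<longlonglongrightarrow> w" "(\<lambda>j. g (x j)) \<longlonglongrightarrow> g a"
  shows "w \<in> subdifferential g a"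
proof -
  have "g a + w \<bullet> (y - a) \<le> g y" for y
  proof (rule LIMSEQ_le_const2)
    show "(\<lambda>j. g (x j) + v j \<bullet> (y - x j)) \<longlonglongrightarrow> g a + w \<bullet> (y - a)"
      using assms by (intro tendsto_intros)
    show "\<exists>N. \<forall>n\<ge>N. g (x n) + v n \<bullet> (y - x n) \<le> g y"
      using assms(1) by (auto simp: subdifferential_def)
  qed
  then show ?thesis by (simp add: subdifferential_def)
qed

section \<open>Multiplier bounds from linear independence\<close>

text \<open>In finite dimension, independence of the limit vectors on \<open>J\<close> gives a lower
  bound \<open>e * norm u\<close> on the norm of their combinations. Half of it survives for nearby
  vectors \<open>G j\<close>, so bounded combinations force bounded coefficients.\<close>

lemma coefficients_bounded:
  fixes G :: "nat \<Rightarrow> 'i::finite \<Rightarrow> 'a::euclidean_space" and z :: "nat \<Rightarrow> real^'i"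
  assumes G: "\<And>i. (\<lambda>j. G j i) \<longlonglongrightarrow> G' i"
    and indep: "\<And>u::real^'i. \<lbrakk>\<And>i. i \<notin> J \<Longrightarrow> u $ i = 0; (\<Sum>i\<in>UNIV. u $ i *\<^sub>R G' i) = 0\<rbrakk> \<Longrightarrow> u = 0"
    and supp: "\<And>j i. i \<notin> J \<Longrightarrow> z j $ i = 0"
    and bdd: "Bseq (\<lambda>j. \<Sum>i\<in>UNIV. z j $ i *\<^sub>R G j i)"
  shows "Bseq z"
proof -
  define T where "T = (\<lambda>u::real^'i. \<Sum>i\<in>UNIV. u $ i *\<^sub>R G' i)"
  define V where "V = {u::real^'i. \<forall>i. i \<notin> J \<longrightarrow> u $ i = 0}"
  have V: "subspace V" by (auto simp: V_def subspace_def)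
  have T: "bounded_linear T"
    unfolding T_def by (intro bounded_linear_sum bounded_linear_scaleR_const
        bounded_linear_vec_nth)
  have inj: "\<forall>u\<in>V. T u = 0 \<longrightarrow> u = 0"
    using indep by (auto simp: V_def T_def)
  obtain e where e: "e > 0" "\<And>u. u \<in> V \<Longrightarrow> norm (T u) \<ge> e * norm u"
    using injective_imp_isometric[OF closed_subspace[OF V] V T inj] by blast
  obtain C where C: "\<And>j. norm (\<Sum>i\<in>UNIV. z j $ i *\<^sub>R G j i) \<le> C"
    using bdd by (auto simp: Bseq_def)
  have "(\<lambda>j. \<Sum>i\<in>UNIV. norm (G j i - G' i)) \<longlonglongrightarrow> (\<Sum>i\<in>(UNIV::'i set). 0)"
    using G by (intro tendsto_sum tendsto_norm_zero) (simp add: LIM_zero)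
  then have "\<forall>\<^sub>F j in sequentially. (\<Sum>i\<in>UNIV. norm (G j i - G' i)) < e / 2"
    using e(1) by (intro order_tendstoD(2)) auto
  then have "\<forall>\<^sub>F j in sequentially. norm (z j) \<le> 2 * C / e"
  proof eventually_elim
    case (elim j)
    let ?P = "\<Sum>i\<in>UNIV. z j $ i *\<^sub>R G j i"
    let ?Q = "\<Sum>i\<in>UNIV. z j $ i *\<^sub>R (G j i - G' i)"
    have "T (z j) = ?P - ?Q"
      by (simp add: T_def sum_subtractf[symmetric] algebra_simps)
    then have "norm (T (z j)) \<le> norm ?P + norm ?Q"
      by (simp only: norm_triangle_ineq4)
    then have "norm (T (z j)) \<le> C + norm ?Q"
      using C[of j] by (rule order_trans[OF _ add_right_mono])
    also have "norm ?Q \<le> (\<Sum>i\<in>UNIV. norm (z j) * norm (G j i - G' i))"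
      by (intro sum_norm_le) (simp add: mult_right_mono component_le_norm_cart)
    also have "\<dots> \<le> norm (z j) * (e / 2)"
      unfolding sum_distrib_left[symmetric] using elim by (intro mult_left_mono) auto
    finally have "norm (T (z j)) \<le> C + norm (z j) * (e / 2)" by simp
    moreover have "e * norm (z j) \<le> norm (T (z j))"
      using e(2) supp by (simp add: V_def)
    ultimately show ?case using e(1) by (simp add: field_simps)
  qed
  \<comment> \<open>\<open>Bseq\<close> is boundedness along \<open>sequentially\<close>, so the
    eventual bound is enough.\<close>
  then show ?thesis by (rule BfunI)
qed

text \<open>The dimension is at most the number of distinct vectors, which is at most
  \<open>card J\<close>. Equality throughout rules out repeated columns and makes the image
  independent.\<close>

lemma dim_image_eq_card_imp_independent:
  fixes F :: "'i::finite \<Rightarrow> 'a::euclidean_space"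
  assumes dim: "dim (F ` J) = card J" and supp: "\<And>i. i \<notin> J \<Longrightarrow> u i = 0"
    and zero: "(\<Sum>i\<in>UNIV. u i *\<^sub>R F i) = 0"
  shows "u i = 0"
proof (cases "i \<in> J")
  case True
  have "dim (F ` J) \<le> card (F ` J)" by (rule dim_le_card') simp
  moreover have "card (F ` J) \<le> card J" by (rule card_image_le) simp
  ultimately have card: "card (F ` J) = card J" using dim by simp
  then have inj: "inj_on F J" by (intro eq_card_imp_inj_on) auto
  have indep: "independent (F ` J)"
    by (rule card_le_dim_spanning[where V = "F ` J"]) (use dim card in \<open>auto simp: span_base\<close>)
  \<comment> \<open>Coefficients are moved from indices to vectors, the form in which independence
    applies.\<close>
  have "(\<Sum>v\<in>F ` J. u (the_inv_into J F v) *\<^sub>R v) = (\<Sum>i\<in>J. u i *\<^sub>R F i)"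
    using inj by (simp add: sum.reindex the_inv_into_f_f)
  also have "\<dots> = (\<Sum>i\<in>UNIV. u i *\<^sub>R F i)"
    using supp by (intro sum.mono_neutral_left) auto
  finally have "u (the_inv_into J F (F i)) = 0"
    using independentD[OF indep, of "F ` J" "\<lambda>v. u (the_inv_into J F v)" "F i"] zero True by auto
  then show ?thesis using inj True by (simp add: the_inv_into_f_f)
qed (rule supp)

lemma sum_UNIV_Plus:
  fixes F :: "'a::finite + 'b::finite \<Rightarrow> 'c::comm_monoid_add"
  shows "(\<Sum>i\<in>UNIV. F i) = (\<Sum>i\<in>UNIV. F (Inl i)) + (\<Sum>i\<in>UNIV. F (Inr i))"
  by (simp add: UNIV_Plus_UNIV[symmetric] sum.Plus del: UNIV_Plus_UNIV)

lemma grad_mat_mult: "grad_mat h x *v \<mu> = (\<Sum>j\<in>UNIV. \<mu> $ j *\<^sub>R gradient (\<lambda>z. h z $ j) x)"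
  by (simp add: vec_eq_iff grad_mat_def matrix_vector_mult_def mult.commute)

text \<open>A single family over a sum type lets all multipliers form one vector over a fixed index
  type; activity of inequality constraints is expressed by the support of that vector.\<close>

definition constraint_gradient ::
  "(real^'n \<Rightarrow> real^'m) \<Rightarrow> ('l::finite \<Rightarrow> real^'n \<Rightarrow> real) \<Rightarrow> real^'n \<Rightarrow> 'm + 'l \<Rightarrow> real^'n"
  where "constraint_gradient h q x i =
    (case i of Inl j \<Rightarrow> gradient (\<lambda>z. h z $ j) x | Inr l \<Rightarrow> gradient (q l) x)"

lemma LICQ_imp_independent:
  fixes h :: "real^'n \<Rightarrow> real^'m" and q :: "'l::finite \<Rightarrow> real^'n \<Rightarrow> real"
    and u :: "real^('m + 'l)"
  assumes "LICQ h q x" and supp: "\<And>l. q l x \<noteq> 0 \<Longrightarrow> u $ Inr l = 0"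
    and zero: "(\<Sum>i\<in>UNIV. u $ i *\<^sub>R constraint_gradient h q x i) = 0"
  shows "u = 0"
proof -
  define I where "I = {l. q l x = 0}"
  define J where "J = (UNIV::'m set) <+> I"
  have "constraint_gradient h q x ` J =
      range (\<lambda>j. gradient (\<lambda>z. h z $ j) x) \<union> (\<lambda>l. gradient (q l) x) ` I"
    unfolding J_def Plus_def image_Un image_image by (simp add: constraint_gradient_def)
  moreover have "card J = CARD('m) + card I" by (simp add: J_def card_Plus)
  ultimately have "dim (constraint_gradient h q x ` J) = card J"
    using assms(1) by (simp add: LICQ_def Let_def I_def)
  moreover have "u $ i = 0" if "i \<notin> J" for i
    using that supp by (cases i) (auto simp: J_def I_def)
  ultimately have "u $ i = 0" for i
    using dim_image_eq_card_imp_independent[of "constraint_gradient h q x" J "\<lambda>i. u $ i"] zero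
    by blast
  then show ?thesis by (simp add: vec_eq_iff)
qed

section \<open>Smooth data along sequences, and consequences of a single iteration\<close>

lemma C1_over_tendsto:
  assumes "C1_over S f" "a \<in> S" "\<And>j. x j \<in> S" "x \<longlonglongrightarrow> a"
  shows "(\<lambda>j. f (x j)) \<longlonglongrightarrow> f a" "(\<lambda>j. gradient f (x j)) \<longlonglongrightarrow> gradient f a"
proof -
  have "isCont f a"
    using assms(1,2) by (auto simp: C1_over_def intro: differentiable_imp_continuous_within)
  then show "(\<lambda>j. f (x j)) \<longlonglongrightarrow> f a"
    using assms(4) by (rule isCont_tendsto_compose)
  show "(\<lambda>j. gradient f (x j)) \<longlonglongrightarrow> gradient f a"
    using assms by (intro continuous_on_tendsto_compose[of S "gradient f"]) (auto simp: C1_over_def)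
qed

lemma UDD_ALM_feasible:
  assumes "UDD_ALM f gt h q \<rho> \<rho>d c \<nu> x \<mu>"
  shows "q l (x k) \<le> 0"
  using assms by (cases k) (auto simp: UDD_ALM_def descent_oracle_def)

text \<open>The oracle's inclusion is rearranged so that all multipliers stand on the left; the
  right-hand side can then be bounded without knowing them.\<close>

lemma UDD_ALM_stationary:
  fixes h :: "real^'n \<Rightarrow> real^'m" and q :: "'l::finite \<Rightarrow> real^'n \<Rightarrow> real"
  assumes "UDD_ALM f gt h q \<rho> \<rho>d c \<nu> x \<mu>"
  shows "\<exists>\<xi> (y::real^'l). \<xi> \<in> subdifferential gt (x (Suc k)) \<and> (\<forall>l. y $ l \<ge> 0) \<and>
    (\<forall>l. y $ l * q l (x (Suc k)) = 0) \<and>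
    grad_mat h (x (Suc k)) *v (\<mu> k + \<rho> *\<^sub>R h (x (Suc k))) +
      (\<Sum>l\<in>UNIV. y $ l *\<^sub>R gradient (q l) (x (Suc k)))
    = - (gradient f (x (Suc k)) + \<xi> + c *\<^sub>R (x (Suc k) - x k))"
proof -
  have "descent_oracle f gt h q \<rho> c \<nu> (x k) (\<mu> k) (x (Suc k))"
    using assms by (simp add: UDD_ALM_def)
  then obtain y :: "real^'l" and \<xi> where
    "\<xi> \<in> subdifferential gt (x (Suc k))" "\<forall>l. y $ l \<ge> 0" "\<forall>l. y $ l * q l (x (Suc k)) = 0"
    and 0: "0 = gradient f (x (Suc k)) + \<xi> +
      grad_mat h (x (Suc k)) *v (\<mu> k + \<rho> *\<^sub>R h (x (Suc k))) + c *\<^sub>R (x (Suc k) - x k) +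
      (\<Sum>l\<in>UNIV. y $ l *\<^sub>R gradient (q l) (x (Suc k)))"
    unfolding descent_oracle_def subdiff_aug_lagrangian_def by blast
  moreover have "a + b = - (d + e + g)" if "0 = d + e + a + g + b" for a b d e g :: "real^'n"
    using that[symmetric] by (simp add: eq_neg_iff_add_eq_0 add_ac del: minus_add_distrib)
  from this[OF 0] show ?thesis using calculation(1-3) by blast
qed

text \<open>The Lagrangian is affine in the multiplier, so the dual update lowers it by exactly
  \<open>\<rho>d * (norm (h (x (Suc k))))\<^sup>2\<close>; the oracle supplies the primal
  part.\<close>

lemma UDD_ALM_descent:
  assumes "UDD_ALM f gt h q \<rho> \<rho>d c \<nu> x \<mu>"
  shows "\<nu> * (norm (x (Suc k) - x k))\<^sup>2 + \<rho>d * (norm (h (x (Suc k))))\<^sup>2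
    \<le> aug_lagrangian f gt h \<rho> (x k) (\<mu> k) - aug_lagrangian f gt h \<rho> (x (Suc k)) (\<mu> (Suc k))"
proof -
  have "aug_lagrangian f gt h \<rho> (x (Suc k)) (\<mu> k)
      \<le> aug_lagrangian f gt h \<rho> (x k) (\<mu> k) - \<nu> * (norm (x (Suc k) - x k))\<^sup>2"
    and "\<mu> (Suc k) = \<mu> k - \<rho>d *\<^sub>R h (x (Suc k))"
    using assms by (auto simp: UDD_ALM_def descent_oracle_def)
  then show ?thesis
    by (simp add: aug_lagrangian_def inner_diff_left power2_norm_eq_inner)
qed

lemma UDD_ALM_eps_KKT:
  assumes udd: "UDD_ALM f gt h q \<rho> \<rho>d c \<nu> x \<mu>"
    and dx: "norm (c *\<^sub>R (x (Suc k) - x k)) \<le> \<epsilon>" and h: "norm (h (x (Suc k))) \<le> \<epsilon>"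
  shows "eps_KKT f gt h q \<epsilon> (x (Suc k))"
proof -
  let ?x = "x (Suc k)" and ?\<mu> = "\<mu> k + \<rho> *\<^sub>R h (x (Suc k))"
  obtain \<xi> y where \<xi>: "\<xi> \<in> subdifferential gt ?x"
    and y: "\<forall>l. y $ l \<ge> 0" "\<forall>l. y $ l * q l ?x = 0"
    and eq: "grad_mat h ?x *v ?\<mu> + (\<Sum>l\<in>UNIV. y $ l *\<^sub>R gradient (q l) ?x)
      = - (gradient f ?x + \<xi> + c *\<^sub>R (?x - x k))"
    using UDD_ALM_stationary[OF udd, of k] by blast
  define z where "z = - gradient f ?x - grad_mat h ?x *v ?\<mu> - (\<Sum>l\<in>UNIV. y $ l *\<^sub>R gradient (q l) ?x)"
  have "z = - gradient f ?x - (grad_mat h ?x *v ?\<mu> + (\<Sum>l\<in>UNIV. y $ l *\<^sub>R gradient (q l) ?x))"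
    unfolding z_def by (simp only: diff_diff_eq)
  then have "z = \<xi> + c *\<^sub>R (?x - x k)"
    unfolding eq by (simp add: algebra_simps)
  then have "norm (\<xi> - z) \<le> \<epsilon>" using dx by simp
  then have "dist_set z (subdifferential gt ?x) \<le> ereal \<epsilon>"
    unfolding dist_set_def using \<xi> by (intro INF_lower2[of \<xi>]) auto
  then show ?thesis
    unfolding eps_KKT_def z_def using y h UDD_ALM_feasible[OF udd] by blast
qed

section \<open>Stationarity of limit points and the limit of the Lagrangian values\<close>

text \<open>Both conclusions rest on one subsequence with convergent multipliers. The second
  supplies the lower bound from which the complexity estimate telescopes.\<close>

lemma UDD_ALM_limit_point:
  fixes f gt :: "real^'n \<Rightarrow> real"
    and h :: "real^'n \<Rightarrow> real^'m"
    and q :: "'l::finite \<Rightarrow> real^'n \<Rightarrow> real"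
  assumes X_def: "X = {z. \<forall>l. q l z \<le> 0}"
    and X_compact: "compact X"
    and q_C1: "\<And>l. C1_over X (q l)"
    and gt_cont: "continuous_on X gt"
    and f_C1: "C1_over X f"
    and h_C1: "\<And>j. C1_over X (\<lambda>z. h z $ j)"
    and params: "\<rho>d > 0" "\<nu> > 0"
    and udd: "UDD_ALM f gt h q \<rho> \<rho>d c \<nu> x \<mu>"
    and r: "strict_mono r" "(x \<circ> r) \<longlonglongrightarrow> a"
    and licq: "LICQ h q a"
  shows "KKT f gt h q a" and "f a + gt a \<le> aug_lagrangian f gt h \<rho> (x k) (\<mu> k)"
proof -
  have xX: "x k \<in> X" for k using UDD_ALM_feasible[OF udd] by (simp add: X_def)
  have aX: "a \<in> X"
    using compact_imp_closed[OF X_compact] _ r(2) by (rule closed_sequentially) (simp add: xX)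
  let ?G = "constraint_gradient h q"
  \<comment> \<open>\<open>J\<close> indexes the columns of the LICQ matrix: all equality
    constraints and the inequalities active at \<open>a\<close>.\<close>
  define J where "J = {i::'m + 'l. \<forall>l. i = Inr l \<longrightarrow> q l a = 0}"

  have "\<forall>\<^sub>F j in sequentially. \<forall>l. q l a \<noteq> 0 \<longrightarrow> q l (x (r j)) \<noteq> 0"
  proof (intro eventually_all_finite)
    fix l
    have "(\<lambda>j. q l (x (r j))) \<longlonglongrightarrow> q l a"
      using C1_over_tendsto(1)[OF q_C1 aX, of "x \<circ> r"] xX r(2) by (simp add: o_def)
    then show "\<forall>\<^sub>F j in sequentially. q l a \<noteq> 0 \<longrightarrow> q l (x (r j)) \<noteq> 0"
      by (cases "q l a = 0") (auto dest: tendsto_imp_eventually_ne)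
  qed
  then obtain N where N: "\<And>j l. j \<ge> N \<Longrightarrow> q l a \<noteq> 0 \<Longrightarrow> q l (x (r j)) \<noteq> 0"
    by (auto simp: eventually_sequentially)
  \<comment> \<open>Stationarity at an iterate is indexed by its predecessor, hence the subtraction;
    it never truncates, as \<open>r (Suc (j + N)) \<ge> Suc (j + N)\<close>. The shift by
    \<open>N\<close> keeps only iterates at which the constraints inactive at \<open>a\<close> are
    inactive too.\<close>
  define s where "s j = r (Suc (j + N)) - 1" for j
  have s: "Suc (s j) = r (Suc (j + N))" for j
    using seq_suble[OF r(1), of "Suc (j + N)"] by (simp add: s_def)
  have s_mono: "strict_mono s"
  proof (rule strict_monoI)
    fix i j :: nat assume "i < j"
    then have "r (Suc (i + N)) < r (Suc (j + N))" using r(1) by (simp add: strict_mono_less)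
    then show "s i < s j" using s[of i] s[of j] by simp
  qed
  have xs: "(\<lambda>j. x (Suc (s j))) \<longlonglongrightarrow> a"
    using LIMSEQ_ignore_initial_segment[OF r(2), of "Suc N"] by (simp add: s)
  have G_lim: "(\<lambda>j. ?G (x (Suc (s j))) i) \<longlonglongrightarrow> ?G a i" for i
    using C1_over_tendsto(2)[OF h_C1 aX xX xs] C1_over_tendsto(2)[OF q_C1 aX xX xs]
    by (cases i) (simp_all add: constraint_gradient_def)

  define P where "P k v u \<longleftrightarrow> v \<in> subdifferential gt (x (Suc k)) \<and> (\<forall>l. u $ l \<ge> 0) \<and>
    (\<forall>l. u $ l * q l (x (Suc k)) = 0) \<and>
    grad_mat h (x (Suc k)) *v (\<mu> k + \<rho> *\<^sub>R h (x (Suc k))) +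
      (\<Sum>l\<in>UNIV. u $ l *\<^sub>R gradient (q l) (x (Suc k)))
    = - (gradient f (x (Suc k)) + v + c *\<^sub>R (x (Suc k) - x k))" for k v and u :: "real^'l"
  have "\<forall>k. \<exists>v u. P k v u" unfolding P_def using UDD_ALM_stationary[OF udd] by blast
  then obtain \<xi> y where P: "\<And>k. P k (\<xi> k) (y k)" by metis
  have \<xi>: "\<xi> k \<in> subdifferential gt (x (Suc k))"
    and y: "y k $ l \<ge> 0" "y k $ l * q l (x (Suc k)) = 0"
    and eq: "grad_mat h (x (Suc k)) *v (\<mu> k + \<rho> *\<^sub>R h (x (Suc k))) +
      (\<Sum>l\<in>UNIV. y k $ l *\<^sub>R gradient (q l) (x (Suc k)))
      = - (gradient f (x (Suc k)) + \<xi> k + c *\<^sub>R (x (Suc k) - x k))" for k l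
    using P[of k] unfolding P_def by blast+
  define z :: "nat \<Rightarrow> real^('m + 'l)" where
    "z k = (\<chi> i. case i of Inl j \<Rightarrow> (\<mu> k + \<rho> *\<^sub>R h (x (Suc k))) $ j | Inr l \<Rightarrow> y k $ l)" for k
  have z_Inl: "z k $ Inl j = \<mu> k $ j + \<rho> * h (x (Suc k)) $ j"
    and z_Inr: "z k $ Inr l = y k $ l" for k j l
    by (simp_all add: z_def)
  have z_eq: "(\<Sum>i\<in>UNIV. z k $ i *\<^sub>R ?G (x (Suc k)) i)
      = - (gradient f (x (Suc k)) + \<xi> k + c *\<^sub>R (x (Suc k) - x k))" for k
    unfolding eq[symmetric] sum_UNIV_Plus grad_mat_mult
    by (simp add: constraint_gradient_def z_def)

  have "bounded (\<Union>x\<in>X. subdifferential gt x)"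
    using X_compact gt_cont
    by (intro bounded_subdifferentials bounded_imp_bdd_below compact_imp_bounded
        compact_continuous_image)
  then obtain B where B: "\<And>p v. p \<in> X \<Longrightarrow> v \<in> subdifferential gt p \<Longrightarrow> norm v \<le> B"
    by (auto simp: bounded_iff)
  have \<xi>_bdd: "Bseq \<xi>" using B xX \<xi> by (intro BseqI') blast
  obtain D where D: "\<And>p. p \<in> X \<Longrightarrow> norm p \<le> D"
    using compact_imp_bounded[OF X_compact] by (auto simp: bounded_iff)
  have "continuous_on X (gradient f)" using f_C1 by (simp add: C1_over_def)
  then have "bounded (gradient f ` X)"
    using X_compact compact_continuous_image compact_imp_bounded by blast
  then obtain E where E: "\<And>p. p \<in> X \<Longrightarrow> norm (gradient f p) \<le> E"
    by (auto simp: bounded_iff)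
  \<comment> \<open>At this stage the increments are only known to be bounded, by compactness of
    \<open>X\<close>; that they vanish follows later from the descent.\<close>
  have "Bseq (\<lambda>k. gradient f (x (Suc k)) + \<xi> k + c *\<^sub>R (x (Suc k) - x k))"
  proof (rule BseqI')
    fix k
    show "norm (gradient f (x (Suc k)) + \<xi> k + c *\<^sub>R (x (Suc k) - x k)) \<le> E + B + \<bar>c\<bar> * (D + D)"
    proof (intro norm_triangle_mono)
      show "norm (c *\<^sub>R (x (Suc k) - x k)) \<le> \<bar>c\<bar> * (D + D)"
        using norm_triangle_ineq4[of "x (Suc k)" "x k"] D[OF xX, of "Suc k"] D[OF xX, of k]
        by (simp add: mult_left_mono)
    qed (use E xX B \<xi> in blast)+
  qed
  then obtain C where C: "\<And>k. norm (\<Sum>i\<in>UNIV. z k $ i *\<^sub>R ?G (x (Suc k)) i) \<le> C"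
    unfolding z_eq norm_minus_cancel Bseq_def by blast
  \<comment> \<open>LICQ is assumed only at \<open>a\<close>, so the bound is claimed only along
    iterates tending to \<open>a\<close>. There complementarity makes the coefficients vanish off
    \<open>J\<close>.\<close>
  have "Bseq (\<lambda>j. z (s j))"
  proof (rule coefficients_bounded[where J = J, OF G_lim])
    fix u :: "real^('m + 'l)"
    assume "\<And>i. i \<notin> J \<Longrightarrow> u $ i = 0" "(\<Sum>i\<in>UNIV. u $ i *\<^sub>R ?G a i) = 0"
    then show "u = 0" using LICQ_imp_independent[OF licq] by (simp add: J_def)
  next
    fix j and i :: "'m + 'l" assume "i \<notin> J"
    then obtain l where l: "i = Inr l" "q l a \<noteq> 0" by (auto simp: J_def)
    then have "q l (x (Suc (s j))) \<noteq> 0" using N[of "Suc (j + N)" l] by (simp add: s)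
    then show "z (s j) $ i = 0" using y(2)[of "s j" l] l by (simp add: z_Inr)
  next
    show "Bseq (\<lambda>j. \<Sum>i\<in>UNIV. z (s j) $ i *\<^sub>R ?G (x (Suc (s j))) i)"
      using C by (intro BseqI') blast
  qed
  \<comment> \<open>Working with pairs lets one extraction serve both multipliers and
    subgradients.\<close>
  then have "bounded (range (\<lambda>j. (z (s j), \<xi> (s j))))"
    using Bseq_subseq[OF \<xi>_bdd, of s]
    by (intro bounded_subset[OF bounded_Times, of "range (\<lambda>j. z (s j))" "range (\<lambda>j. \<xi> (s j))"])
      (auto simp: Bseq_eq_bounded)
  then obtain w t where t: "strict_mono t" "((\<lambda>j. (z (s j), \<xi> (s j))) \<circ> t) \<longlonglongrightarrow> w"
    using bounded_imp_convergent_subsequence by blast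
  define k where "k = s \<circ> t"
  have k_mono: "strict_mono k" unfolding k_def using s_mono t(1) by (rule strict_mono_o)
  obtain zs \<xi>s where w: "w = (zs, \<xi>s)" by (cases w)
  have z_lim: "(\<lambda>j. z (k j)) \<longlonglongrightarrow> zs" and \<xi>_lim: "(\<lambda>j. \<xi> (k j)) \<longlonglongrightarrow> \<xi>s"
    using tendsto_fst[OF t(2)] tendsto_snd[OF t(2)] by (simp_all add: w k_def o_def)
  have x_lim: "(\<lambda>j. x (Suc (k j))) \<longlonglongrightarrow> a"
    using LIMSEQ_subseq_LIMSEQ[OF xs t(1)] by (simp add: k_def o_def)
  have G_lim: "(\<lambda>j. ?G (x (Suc (k j))) i) \<longlonglongrightarrow> ?G a i" for i
    using LIMSEQ_subseq_LIMSEQ[OF G_lim t(1)] by (simp add: k_def o_def)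
  have q_lim: "(\<lambda>j. q l (x (Suc (k j)))) \<longlonglongrightarrow> q l a" for l
    by (rule C1_over_tendsto(1)[OF q_C1 aX xX x_lim])
  have f_lim: "(\<lambda>j. f (x (Suc (k j)))) \<longlonglongrightarrow> f a"
    "(\<lambda>j. gradient f (x (Suc (k j)))) \<longlonglongrightarrow> gradient f a"
    by (rule C1_over_tendsto[OF f_C1 aX xX x_lim])+
  have gt_lim: "(\<lambda>j. gt (x (Suc (k j)))) \<longlonglongrightarrow> gt a"
    using xX by (intro continuous_on_tendsto_compose[OF gt_cont x_lim aX]) simp
  have h_lim: "(\<lambda>j. h (x (Suc (k j)))) \<longlonglongrightarrow> h a"
    by (intro vec_tendstoI C1_over_tendsto(1)[OF h_C1 aX xX x_lim])
  \<comment> \<open>By the dual update, \<open>\<mu> (Suc k)\<close> is the \<open>Inl\<close> part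
    of \<open>z k\<close> minus \<open>(\<rho> + \<rho>d) *\<^sub>R h (x (Suc k))\<close>; this is
    the limit of that expression.\<close>
  define \<mu>s where "\<mu>s = (\<chi> j. zs $ Inl j) - (\<rho> + \<rho>d) *\<^sub>R h a"
  have \<mu>_lim: "(\<lambda>j. \<mu> (Suc (k j))) \<longlonglongrightarrow> \<mu>s"
  proof -
    have "(\<chi> i. z k $ Inl i) - (\<rho> + \<rho>d) *\<^sub>R h (x (Suc k)) = \<mu> (Suc k)" for k
      using udd by (simp add: UDD_ALM_def vec_eq_iff z_Inl algebra_simps)
    moreover have "(\<lambda>j. (\<chi> i. z (k j) $ Inl i) - (\<rho> + \<rho>d) *\<^sub>R h (x (Suc (k j)))) \<longlonglongrightarrow> \<mu>s"
      unfolding \<mu>s_def by (intro tendsto_intros z_lim h_lim)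
    ultimately show ?thesis by simp
  qed

  define L where "L k = aug_lagrangian f gt h \<rho> (x k) (\<mu> k)" for k
  define La where "La = aug_lagrangian f gt h \<rho> a \<mu>s"
  have L_lim: "(\<lambda>j. L (Suc (k j))) \<longlonglongrightarrow> La"
    unfolding L_def La_def aug_lagrangian_def
    by (intro tendsto_intros f_lim gt_lim h_lim \<mu>_lim)
  define d where "d k = \<nu> * (norm (x (Suc k) - x k))\<^sup>2 + \<rho>d * (norm (h (x (Suc k))))\<^sup>2" for k
  have d: "0 \<le> d k" "d k \<le> L k - L (Suc k)" for k
    using UDD_ALM_descent[OF udd, of k] params by (simp_all add: d_def L_def)
  have L_dec: "decseq L"
  proof (rule decseq_SucI)
    show "L (Suc k) \<le> L k" for k using d[of k] by linarith
  qed
  have L_ge: "La \<le> L n" for n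
  proof (rule LIMSEQ_le_const2[OF L_lim])
    have "L (Suc (k j)) \<le> L n" if "j \<ge> n" for j
      using that seq_suble[OF k_mono, of j] by (intro decseqD[OF L_dec]) simp
    then show "\<exists>N. \<forall>j\<ge>N. L (Suc (k j)) \<le> L n" by blast
  qed
  \<comment> \<open>Monotonicity and the bound \<open>La\<close> give convergence of the whole
    sequence, so the consecutive values \<open>L k\<close> and \<open>L (Suc k)\<close> share their
    limit.\<close>
  have "L \<longlonglongrightarrow> (INF n. L n)"
    using L_ge L_dec by (intro LIMSEQ_decseq_INF bdd_belowI2)
  then have "(\<lambda>k. L k - L (Suc k)) \<longlonglongrightarrow> 0"
    using tendsto_diff[of L _ _ "\<lambda>k. L (Suc k)"] LIMSEQ_Suc[of L] by fastforce
  then have d_lim: "d \<longlonglongrightarrow> 0"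
    by (rule tendsto_sandwich[OF _ _ tendsto_const, rotated 2]) (auto simp: d)
  \<comment> \<open>Stated for any normed space because it serves both the primal increments and the
    constraint values.\<close>
  have vanish: "v \<longlonglongrightarrow> 0" if "\<sigma> > 0" "\<And>k. \<sigma> * (norm (v k))\<^sup>2 \<le> d k"
    for \<sigma> and v :: "nat \<Rightarrow> 'v::real_normed_vector"
  proof -
    have "(\<lambda>k. (norm (v k))\<^sup>2) \<longlonglongrightarrow> 0"
    proof (rule tendsto_sandwich[OF _ _ tendsto_const])
      show "(\<lambda>k. d k / \<sigma>) \<longlonglongrightarrow> 0" using tendsto_divide_zero[OF d_lim] .
    qed (use that in \<open>auto simp: field_simps\<close>)
    then have "(\<lambda>k. sqrt ((norm (v k))\<^sup>2)) \<longlonglongrightarrow> sqrt 0" by (rule tendsto_real_sqrt)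
    then show ?thesis by (simp add: tendsto_norm_zero_iff)
  qed
  have "(\<lambda>k. x (Suc k) - x k) \<longlonglongrightarrow> 0"
    by (rule vanish[of \<nu>]) (use params in \<open>auto simp: d_def\<close>)
  then have dx_lim: "(\<lambda>j. x (Suc (k j)) - x (k j)) \<longlonglongrightarrow> 0"
    using LIMSEQ_subseq_LIMSEQ[OF _ k_mono] by (fastforce simp: o_def)
  have "(\<lambda>k. h (x (Suc k))) \<longlonglongrightarrow> 0"
    by (rule vanish[of \<rho>d]) (use params in \<open>auto simp: d_def\<close>)
  then have "(\<lambda>j. h (x (Suc (k j)))) \<longlonglongrightarrow> 0"
    using LIMSEQ_subseq_LIMSEQ[OF _ k_mono] by (fastforce simp: o_def)
  then have ha: "h a = 0" using h_lim LIMSEQ_unique by blast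
  \<comment> \<open>At the feasible point \<open>a\<close> the multiplier and penalty terms of
    \<open>La\<close> vanish.\<close>
  have "f a + gt a \<le> L k" for k
    using L_ge[of k] ha by (simp add: La_def aug_lagrangian_def)
  then show "f a + gt a \<le> aug_lagrangian f gt h \<rho> (x k) (\<mu> k)" for k
    by (simp add: L_def)

  have \<xi>s: "\<xi>s \<in> subdifferential gt a"
    by (rule subdifferential_limit[OF \<xi> x_lim \<xi>_lim gt_lim])
  \<comment> \<open>The same sums are taken to the limit twice, termwise and through the
    stationarity equation, where the proximal term disappears.\<close>
  have "(\<lambda>j. \<Sum>i\<in>UNIV. z (k j) $ i *\<^sub>R ?G (x (Suc (k j))) i) \<longlonglongrightarrow> (\<Sum>i\<in>UNIV. zs $ i *\<^sub>R ?G a i)"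
    by (intro tendsto_intros z_lim G_lim)
  moreover have "(\<lambda>j. \<Sum>i\<in>UNIV. z (k j) $ i *\<^sub>R ?G (x (Suc (k j))) i) \<longlonglongrightarrow> - (gradient f a + \<xi>s + c *\<^sub>R 0)"
    unfolding z_eq by (intro tendsto_intros f_lim \<xi>_lim dx_lim)
  ultimately have "(\<Sum>i\<in>UNIV. zs $ i *\<^sub>R ?G a i) = - (gradient f a + \<xi>s)"
    using LIMSEQ_unique by fastforce
  then have "grad_mat h a *v (\<chi> j. zs $ Inl j) +
      (\<Sum>l\<in>UNIV. (\<chi> l. zs $ Inr l) $ l *\<^sub>R gradient (q l) a) = - (gradient f a + \<xi>s)"
    unfolding sum_UNIV_Plus grad_mat_mult by (simp add: constraint_gradient_def)
  then have "- gradient f a - grad_mat h a *v (\<chi> j. zs $ Inl j)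
      - (\<Sum>l\<in>UNIV. (\<chi> l. zs $ Inr l) $ l *\<^sub>R gradient (q l) a) = \<xi>s"
    unfolding diff_diff_eq by simp
  moreover have "dist_set \<xi>s (subdifferential gt a) \<le> ereal 0"
    unfolding dist_set_def using \<xi>s by (intro INF_lower2[of \<xi>s]) auto
  moreover have "zs $ Inr l \<ge> 0" for l
    by (rule LIMSEQ_le_const[OF tendsto_vec_nth[OF z_lim]]) (use y(1) in \<open>auto simp: z_Inr\<close>)
  moreover have "zs $ Inr l * q l a = 0" for l
  proof -
    have "(\<lambda>j. z (k j) $ Inr l * q l (x (Suc (k j)))) \<longlonglongrightarrow> zs $ Inr l * q l a"
      by (intro tendsto_intros z_lim q_lim)
    then show ?thesis by (simp add: z_Inr y(2) LIMSEQ_const_iff)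
  qed
  moreover have "q l a \<le> 0" for l using aX by (simp add: X_def)
  ultimately show "KKT f gt h q a"
    unfolding KKT_def eps_KKT_def using ha
    by (intro exI[of _ "\<chi> j. zs $ Inl j"] exI[of _ "\<chi> l. zs $ Inr l"]) simp
qed

section \<open>Iteration complexity\<close>

text \<open>This allows the supremum in \<open>\<sigma>2\<close> to be compared with its members.
  The operator norm is at most the sum of the column norms, which is continuous on the compact set
  \<open>X\<close>.\<close>

lemma bdd_above_onorm_grad_mat:
  fixes h :: "real^'n \<Rightarrow> real^'m"
  assumes "compact X" and "\<And>j. C1_over X (\<lambda>z. h z $ j)"
  shows "bdd_above ((\<lambda>z. onorm (\<lambda>v. grad_mat h z *v v)) ` X)"
proof -
  let ?g = "\<lambda>j. gradient (\<lambda>z. h z $ j)"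
  have "continuous_on X (\<lambda>z. \<Sum>j\<in>UNIV. norm (?g j z))"
    using assms(2) by (intro continuous_intros) (simp add: C1_over_def)
  then have "bdd_above ((\<lambda>z. \<Sum>j\<in>UNIV. norm (?g j z)) ` X)"
    using assms(1) by (intro bounded_imp_bdd_above compact_imp_bounded compact_continuous_image)
  moreover have "onorm (\<lambda>v. grad_mat h z *v v) \<le> (\<Sum>j\<in>UNIV. norm (?g j z))" for z
  proof (rule onorm_le)
    fix v :: "real^'m"
    have "norm (\<Sum>j\<in>UNIV. v $ j *\<^sub>R ?g j z) \<le> (\<Sum>j\<in>UNIV. norm (?g j z) * norm v)"
      by (intro sum_norm_le)
        (simp add: mult.commute[of _ "norm v"] mult_right_mono component_le_norm_cart)
    then show "norm (grad_mat h z *v v) \<le> (\<Sum>j\<in>UNIV. norm (?g j z)) * norm v"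
      by (simp add: grad_mat_mult sum_distrib_right)
  qed
  ultimately show ?thesis
    unfolding bdd_above_def by (blast intro: order_trans)
qed

text \<open>For \<open>\<epsilon> < 1\<close> the rounding error of the ceiling is absorbed by
  \<open>1 / \<epsilon>\<^sup>2 \<ge> 1\<close>.\<close>

lemma ceiling_bigo_inverse_square:
  fixes C \<sigma> :: real
  shows "(\<lambda>\<epsilon>. real_of_int \<lceil>C / (\<sigma> * \<epsilon>\<^sup>2)\<rceil>) \<in> O[at_right 0](\<lambda>\<epsilon>. 1 / \<epsilon>\<^sup>2)"
proof (rule bigoI)
  have "\<forall>\<^sub>F \<epsilon> in at_right (0::real). \<epsilon> \<in> {0<..<1}"
    by (rule eventually_at_right_real) simp
  then show "\<forall>\<^sub>F \<epsilon> in at_right 0. norm (real_of_int \<lceil>C / (\<sigma> * \<epsilon>\<^sup>2)\<rceil>) \<le> (\<bar>C / \<sigma>\<bar> + 1) * norm (1 / \<epsilon>\<^sup>2)"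
  proof eventually_elim
    case (elim \<epsilon>)
    have "\<epsilon>\<^sup>2 \<le> 1" using elim by (simp add: power_le_one)
    then have 1: "1 \<le> 1 / \<epsilon>\<^sup>2" using elim by simp
    have "\<bar>real_of_int \<lceil>C / (\<sigma> * \<epsilon>\<^sup>2)\<rceil>\<bar> \<le> \<bar>C / (\<sigma> * \<epsilon>\<^sup>2)\<bar> + 1" by linarith
    also have "\<bar>C / (\<sigma> * \<epsilon>\<^sup>2)\<bar> = \<bar>C / \<sigma>\<bar> * (1 / \<epsilon>\<^sup>2)" by (simp add: abs_mult)
    also have "\<dots> + 1 \<le> (\<bar>C / \<sigma>\<bar> + 1) * (1 / \<epsilon>\<^sup>2)"
      using 1 by (simp only: distrib_right)
    finally show ?case by simp
  qed
qed

text \<open>Pigeonhole: the decreases over \<open>K\<close> steps sum to at most the initial gap, so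
  one of them is at most the average, and \<open>K\<close> is large enough for that average to force
  both residuals below \<open>\<epsilon>\<close>.\<close>

lemma UDD_ALM_complexity:
  assumes udd: "UDD_ALM f gt h q \<rho> \<rho>d c \<nu> x \<mu>"
    and lower: "\<And>k. Linf \<le> aug_lagrangian f gt h \<rho> (x k) (\<mu> k)"
    and pos: "0 < \<sigma>" "\<sigma> \<le> \<nu>" "\<sigma> \<le> \<rho>d" "0 \<le> c" "0 < \<epsilon>" and M: "1 \<le> M" "c \<le> M"
  shows "\<exists>K::nat. int K \<le> \<lceil>M\<^sup>2 * (aug_lagrangian f gt h \<rho> (x 0) (\<mu> 0) - Linf) / (\<sigma> * \<epsilon>\<^sup>2)\<rceil> \<and>
    (\<exists>k\<le>K. eps_KKT f gt h q \<epsilon> (x k))"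
proof -
  define L where "L k = aug_lagrangian f gt h \<rho> (x k) (\<mu> k)" for k
  define \<Delta> where "\<Delta> = L 0 - Linf"
  have \<Delta>: "0 \<le> \<Delta>" using lower[of 0] by (simp add: \<Delta>_def L_def)
  define d where "d k = \<nu> * (norm (x (Suc k) - x k))\<^sup>2 + \<rho>d * (norm (h (x (Suc k))))\<^sup>2" for k
  have d_le: "d k \<le> L k - L (Suc k)" for k
    using UDD_ALM_descent[OF udd, of k] by (simp add: d_def L_def)
  have dx: "\<sigma> * (norm (x (Suc k) - x k))\<^sup>2 \<le> d k" and dh: "\<sigma> * (norm (h (x (Suc k))))\<^sup>2 \<le> d k" for k
    using pos mult_right_mono[of \<sigma> \<nu> "(norm (x (Suc k) - x k))\<^sup>2"]
      mult_right_mono[of \<sigma> \<rho>d "(norm (h (x (Suc k))))\<^sup>2"]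
    by (auto simp: d_def intro: order_trans add_increasing add_increasing2)
  \<comment> \<open>The threshold makes \<open>M\<close> times each of the norms of the increment
    and of \<open>h\<close> at most \<open>\<epsilon>\<close>; \<open>c \<le> M\<close> and
    \<open>1 \<le> M\<close> then bound the two residuals.\<close>
  have KKT: "eps_KKT f gt h q \<epsilon> (x (Suc k))" if k: "M\<^sup>2 * d k \<le> \<sigma> * \<epsilon>\<^sup>2" for k
  proof -
    have small: "M * a \<le> \<epsilon>" if "\<sigma> * a\<^sup>2 \<le> d k" for a
    proof -
      have "M\<^sup>2 * (\<sigma> * a\<^sup>2) \<le> \<sigma> * \<epsilon>\<^sup>2"
        using mult_left_mono[OF that, of "M\<^sup>2"] k by simp
      then have "\<sigma> * (M * a)\<^sup>2 \<le> \<sigma> * \<epsilon>\<^sup>2" by (simp add: power_mult_distrib algebra_simps)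
      then have "(M * a)\<^sup>2 \<le> \<epsilon>\<^sup>2" using pos(1) by simp
      then show ?thesis by (rule power2_le_imp_le) (use pos(5) in simp)
    qed
    show ?thesis
    proof (rule UDD_ALM_eps_KKT[OF udd])
      show "norm (c *\<^sub>R (x (Suc k) - x k)) \<le> \<epsilon>"
        using small[OF dx] mult_right_mono[OF M(2), of "norm (x (Suc k) - x k)"] pos(4) by simp
      show "norm (h (x (Suc k))) \<le> \<epsilon>"
        using small[OF dh] mult_right_mono[OF M(1), of "norm (h (x (Suc k)))"] by simp
    qed
  qed
  define b where "b = M\<^sup>2 * \<Delta> / (\<sigma> * \<epsilon>\<^sup>2)"
  define K where "K = nat \<lceil>b\<rceil>"
  have b: "0 \<le> b" using \<Delta> pos(1) by (simp add: b_def)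
  then have K: "int K = \<lceil>b\<rceil>" by (simp add: K_def)
  have "\<exists>k\<le>K. eps_KKT f gt h q \<epsilon> (x k)"
  proof (cases "\<Delta> = 0")
    case True
    \<comment> \<open>Here \<open>K = 0\<close>: there is no decrease left, so the first step does not move.\<close>
    have "d 0 \<le> 0" using d_le[of 0] lower[of "Suc 0"] True by (simp add: \<Delta>_def L_def)
    then have "\<sigma> * (norm (x (Suc 0) - x 0))\<^sup>2 \<le> 0" using dx[of 0] by linarith
    then have "x (Suc 0) = x 0" using pos(1) by (simp add: mult_le_0_iff)
    moreover have "M\<^sup>2 * d 0 \<le> \<sigma> * \<epsilon>\<^sup>2"
      using \<open>d 0 \<le> 0\<close> pos(1) by (intro order.trans[OF mult_nonneg_nonpos mult_nonneg_nonneg]) auto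
    ultimately have "eps_KKT f gt h q \<epsilon> (x 0)" using KKT[of 0] by simp
    then show ?thesis by blast
  next
    case False
    then have "0 < b" using \<Delta> pos M by (simp add: b_def)
    then have K_pos: "0 < K" by (simp add: K_def)
    have "\<exists>k<K. d k \<le> \<Delta> / K"
    proof (rule ccontr)
      assume "\<not> (\<exists>k<K. d k \<le> \<Delta> / K)"
      then have "\<Delta> / K < d k" if "k < K" for k using that not_le by blast
      then have "(\<Sum>k<K. \<Delta> / K) < (\<Sum>k<K. d k)"
        using K_pos by (intro sum_strict_mono) auto
      also have "\<dots> \<le> (\<Sum>k<K. L k - L (Suc k))" by (intro sum_mono d_le)
      also have "\<dots> = L 0 - L K" by (rule sum_lessThan_telescope')
      also have "\<dots> \<le> \<Delta>" using lower[of K] by (simp add: \<Delta>_def L_def)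
      finally show False using K_pos by simp
    qed
    then obtain k where k: "k < K" "d k \<le> \<Delta> / K" by blast
    have "b \<le> real K" unfolding K_def by (rule real_nat_ceiling_ge)
    then have "M\<^sup>2 * (\<Delta> / K) \<le> \<sigma> * \<epsilon>\<^sup>2"
      using pos K_pos by (simp add: b_def field_simps)
    moreover have "M\<^sup>2 * d k \<le> M\<^sup>2 * (\<Delta> / K)" using k(2) by (intro mult_left_mono) auto
    ultimately have "eps_KKT f gt h q \<epsilon> (x (Suc k))" by (intro KKT) linarith
    \<comment> \<open>Step \<open>k\<close> certifies the iterate \<open>Suc k\<close>, which is
      still within \<open>K\<close> because \<open>k < K\<close>.\<close>
    then show ?thesis using k(1) Suc_leI by blast
  qed
  then show ?thesis
    using K unfolding b_def \<Delta>_def L_def by (intro exI[of _ K]) simp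
qed

theorem theoremB6:
  fixes f gt :: "real^'n \<Rightarrow> real"
    and h :: "real^'n \<Rightarrow> real^'m"
    and q :: "'l::finite \<Rightarrow> real^'n \<Rightarrow> real"
    and X :: "(real^'n) set"
    and \<rho> \<rho>d c \<nu> \<sigma>1 \<sigma>2 :: real
    and x :: "nat \<Rightarrow> real^'n" and \<mu> :: "nat \<Rightarrow> real^'m"
    and xstar :: "real^'n"
  assumes X_def: "X = {z. \<forall>l. q l z \<le> 0}"
    and X_compact: "compact X"
    and q_C1: "\<forall>l. C1_over UNIV (q l)"
    and gt_cont: "continuous_on X gt"
    and gt_convex: "convex_over X gt"
    and f_C1: "C1_over X f"
    and h_C1: "\<forall>j. C1_over X (\<lambda>z. h z $ j)"
    and params: "\<rho> \<ge> 0" "\<rho>d > 0" "c > 0" "\<nu> > 0"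
    and generated: "UDD_ALM f gt h q \<rho> \<rho>d c \<nu> x \<mu>"
    and xstar_in: "xstar \<in> X"
    and limit_point: "\<exists>r. strict_mono r \<and> (x \<circ> r) \<longlonglongrightarrow> xstar"
    and licq: "LICQ h q xstar"
    and \<sigma>1_def: "\<sigma>1 = min \<nu> \<rho>d"
    and \<sigma>2_def: "\<sigma>2 = c + (\<rho> + \<rho>d) * (SUP z\<in>X. onorm (\<lambda>v. grad_mat h z *v v))"
  shows "KKT f gt h q xstar \<and>
    (let bound = (\<lambda>\<epsilon>::real. \<lceil>(max 1 \<sigma>2)\<^sup>2 *
           (aug_lagrangian f gt h \<rho> (x 0) (\<mu> 0) - f xstar - gt xstar) / (\<sigma>1 * \<epsilon>\<^sup>2)\<rceil>)
     in (\<forall>\<epsilon>>0. \<exists>K::nat. int K \<le> bound \<epsilon> \<and> (\<exists>k\<le>K. eps_KKT f gt h q \<epsilon> (x k))) \<and>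
        (\<lambda>\<epsilon>. real_of_int (bound \<epsilon>)) \<in> O[at_right 0](\<lambda>\<epsilon>. 1 / \<epsilon>\<^sup>2))"
proof -
  obtain r where r: "strict_mono r" "(x \<circ> r) \<longlonglongrightarrow> xstar" using limit_point by blast
  have q: "C1_over X (q l)" for l
    using q_C1 by (auto simp: C1_over_def intro: continuous_on_subset)
  have h: "C1_over X (\<lambda>z. h z $ j)" for j using h_C1 by blast
  note lim = UDD_ALM_limit_point[OF X_def X_compact q gt_cont f_C1 h params(2,4) generated r licq]
  have "0 \<le> onorm (\<lambda>v. grad_mat h xstar *v v)"
    by (rule onorm_pos_le) (rule matrix_vector_mul_bounded_linear)
  \<comment> \<open>One nonnegative member, at \<open>xstar\<close>, suffices since the family is
    bounded above.\<close>
  then have "0 \<le> (SUP z\<in>X. onorm (\<lambda>v. grad_mat h z *v v))"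
    using bdd_above_onorm_grad_mat[OF X_compact h] xstar_in by (intro cSUP_upper2) auto
  then have "c \<le> \<sigma>2" using params by (simp add: \<sigma>2_def)
  \<comment> \<open>\<open>max 1 \<sigma>2\<close> dominates both scale factors: \<open>1\<close>
    for feasibility and \<open>c\<close> for stationarity.\<close>
  then have M: "1 \<le> max 1 \<sigma>2" "c \<le> max 1 \<sigma>2" by auto
  have \<sigma>1: "0 < \<sigma>1" "\<sigma>1 \<le> \<nu>" "\<sigma>1 \<le> \<rho>d" using params by (auto simp: \<sigma>1_def)
  show ?thesis
    unfolding Let_def
  proof (intro conjI allI impI lim(1) ceiling_bigo_inverse_square)
    fix \<epsilon> :: real assume "0 < \<epsilon>"
    then show "\<exists>K::nat. int K \<le> \<lceil>(max 1 \<sigma>2)\<^sup>2 *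
        (aug_lagrangian f gt h \<rho> (x 0) (\<mu> 0) - f xstar - gt xstar) / (\<sigma>1 * \<epsilon>\<^sup>2)\<rceil> \<and>
        (\<exists>k\<le>K. eps_KKT f gt h q \<epsilon> (x k))"
      using UDD_ALM_complexity[OF generated lim(2) \<sigma>1 less_imp_le[OF params(3)] _ M, of \<epsilon>]
      by (simp add: diff_diff_eq)
  qed
qed

end
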